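(* For every $S\subset V$, the expected information gain $$\Psi(S)=\tfrac12\log\det\big(\widetilde{\mathscr{F}}^\top\mathbf{P}(S)\widetilde{\mathscr{F}}+\mathbf{I}\big)$$ satisfies $$\Psi(S)=\frac12\log\left[\frac{\det\big(\mathbf{\Pi}(S)(\widetilde{\mathscr{F}}\widetilde{\mathscr{F}}^\top+\mathbf{\Gamma}_{\mathbf{e}})\mathbf{\Pi}(S)^\top\big)}{\det\big(\mathbf{\Pi}(S)\mathbf{\Gamma}_{\mathbf{e}}\mathbf{\Pi}(S)^\top\big)}\right].$$
   Context: $V=\{1,\dots,d\}$ indexes the candidate sensors of $K$ types, type $i$ having $s_i$ candidates, $d=\sum_{i=1}^K s_i$. The composite linear parameter-to-observable map is the matrix $\mathscr{F}=[\mathbf{F}_1^\top\ \cdots\ \mathbf{F}_K^\top]^\top\in\mathbb{R}^{d\times n}$ with $\mathbf{F}_i\in\mathbb{R}^{s_i\times n}$. The parameter $\mathbf{m}\in\mathbb{R}^n$ has Gaussian prior with symmetric positive definite covariance $\mathbf{\Gamma}_{\mathbf{m}\mathbf{m}}$, and $\widetilde{\mathscr{F}}=\mathscr{F}\mathbf{\Gamma}_{\mathbf{m}\mathbf{m}}^{1/2}$. The noise covariance $\mathbf{\Gamma}_{\mathbf{e}}=\mathrm{blockdiag}(\mathbf{\Gamma}^1_{\mathbf{e}},\dots,\mathbf{\Gamma}^K_{\mathbf{e}})\in\mathbb{R}^{d\times d}$ is symmetric positive definite. For $S\subset V$, $\mathbf{\Pi}(S)\in\{0,1\}^{|S|\times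 d}$ is the row-selection matrix consisting of the rows of the $d\times d$ identity matrix indexed by $S$, and $$\mathbf{P}(S)=\mathbf{\Pi}(S)^\top\big(\mathbf{\Pi}(S)\mathbf{\Gamma}_{\mathbf{e}}\mathbf{\Pi}(S)^\top\big)^{-1}\mathbf{\Pi}(S).$$ $\mathbf{I}$ is the $n\times n$ identity matrix. *)

theory Defs
  imports
    Complex_Main
    "Jordan_Normal_Form.Gauss_Jordan_Elimination"
    "Jordan_Normal_Form.Determinant"
    "Jordan_Normal_Form.DL_Submatrix"
begin

(* Matrices are the dimension-carrying matrices of Jordan_Normal_Form, since the number of rows
   of the selection matrix depends on the set S.  Their rows and columns are numbered from 0, so
   the d candidate sensors are represented by V = {0..<d}. *)

definition sym_pos_def :: "nat \<Rightarrow> real mat \<Rightarrow> bool" where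
  "sym_pos_def n A \<longleftrightarrow> A \<in> carrier_mat n n \<and> transpose_mat A = A \<and>
     (\<forall>x \<in> carrier_vec n. x \<noteq> 0\<^sub>v n \<longrightarrow> x \<bullet> (A *\<^sub>v x) > 0)"

(* The principal square root; meaningful only for symmetric positive definite A, where it is the
   unique symmetric positive definite B with B * B = A. *)
definition spd_sqrt :: "real mat \<Rightarrow> real mat" where
  "spd_sqrt A = (THE B. sym_pos_def (dim_row A) B \<and> B * B = A)"

(* The library's mat_inverse returns None on singular matrices, where the value below is
   unspecified. *)
definition minv :: "real mat \<Rightarrow> real mat" where
  "minv A = the (mat_inverse A)"

(* The number n of columns is needed for the empty list. *)
definition stack_rows :: "nat \<Rightarrow> real mat list \<Rightarrow> real mat" where
  "stack_rows n As = foldr (@\<^sub>r) As (0\<^sub>m 0 n)"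

(* submatrix keeps the selected rows in increasing order of their index. *)
definition selection_mat :: "nat \<Rightarrow> nat set \<Rightarrow> real mat" where
  "selection_mat d S = submatrix (1\<^sub>m d) S UNIV"

definition select_precision :: "real mat \<Rightarrow> nat set \<Rightarrow> real mat" where
  "select_precision \<Gamma>e S =
     (let Sel = selection_mat (dim_row \<Gamma>e) S
      in transpose_mat Sel * minv (Sel * \<Gamma>e * transpose_mat Sel) * Sel)"

(* The argument Ft is the prior-preconditioned map F * Gamma_mm^(1/2). *)
definition expected_information_gain :: "real mat \<Rightarrow> real mat \<Rightarrow> nat set \<Rightarrow> real" where
  "expected_information_gain Ft \<Gamma>e S =
     1 / 2 * ln (det (transpose_mat Ft * select_precision \<Gamma>e S * Ft + 1\<^sub>m (dim_col Ft)))"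

end

theory Submission
  imports Defs
begin

text \<open>
  Write \<open>P\<close> for the selection matrix of \<open>S\<close>, \<open>A = P \<Gamma>e P\<^sup>T\<close> for the noise covariance of the
  selected sensors, and \<open>U = P Ft\<close> for the selected rows of the preconditioned map. The matrix in
  the information gain is \<open>U\<^sup>T A\<^sup>-\<^sup>1 U + I\<close>, whose size is the number of parameters, while the
  matrix in the numerator on the right is \<open>U U\<^sup>T + A\<close>, whose size is the number of selected sensors.
  The matrix determinant lemma \<open>det A * det (V A\<^sup>-\<^sup>1 U + I) = det (U V + A)\<close> relates the two sizes;
  it is Sylvester's identity \<open>det (I + X Y) = det (I + Y X)\<close>
  (\<open>det_mult_plus_one_commute\<close>) for \<open>X = V\<close> and \<open>Y = A\<^sup>-\<^sup>1 U\<close>, multiplied by \<open>det A\<close>.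

  Dividing by \<open>det A\<close> requires \<open>A\<close> to be invertible. This follows from the positive definiteness of
  \<open>\<Gamma>e\<close>: the rows of \<open>P\<close> are distinct unit vectors, so \<open>P P\<^sup>T = I\<close> and
  \<open>P\<^sup>T\<close> is injective, and a compression of a positive definite matrix along an injective map is
  positive definite.
\<close>

section \<open>Determinant identities\<close>

text \<open>
  Multiplying the block matrix with rows \<open>(I, -Y)\<close> and \<open>(X, I)\<close> by the unipotent matrix with rows
  \<open>(I, Y)\<close> and \<open>(0, I)\<close> on the right and on the left clears its upper right block in both cases. The
  remaining diagonal blocks are \<open>(I, X Y + I)\<close> and \<open>(Y X + I, I)\<close>, so both sides equal its determinant.
\<close>

lemma det_mult_plus_one_commute:
  fixes X Y :: "'a :: idom mat"
  assumes X: "X \<in> carrier_mat m k" and Y: "Y \<in> carrier_mat k m"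
  shows "det (X * Y + 1\<^sub>m m) = det (Y * X + 1\<^sub>m k)"
proof -
  let ?M = "four_block_mat (1\<^sub>m k) (- Y) X (1\<^sub>m m)"
  let ?N = "four_block_mat (1\<^sub>m k) Y (0\<^sub>m m k) (1\<^sub>m m)"
  have M: "?M \<in> carrier_mat (k + m) (k + m)" and N: "?N \<in> carrier_mat (k + m) (k + m)"
    by auto
  have YX: "Y * X \<in> carrier_mat k k" and XY: "X * Y \<in> carrier_mat m m"
    using X Y by auto
  have detN: "det ?N = 1"
    using Y by (subst det_four_block_mat_lower_left_zero[of _ k _ m]) auto
  have cancel: "Y + - Y = 0\<^sub>m k m" "- Y + Y = 0\<^sub>m k m"
    using Y by auto
  have "?M * ?N = four_block_mat (1\<^sub>m k) (0\<^sub>m k m) X (X * Y + 1\<^sub>m m)"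
    using X Y by (subst mult_four_block_mat[of _ k k _ m _ m _ _ k _ m]) (auto simp: cancel)
  hence "det (?M * ?N) = det (X * Y + 1\<^sub>m m)"
    using X XY by (simp add: det_four_block_mat_upper_right_zero[of _ k _ m])
  moreover have "?N * ?M = four_block_mat (Y * X + 1\<^sub>m k) (0\<^sub>m k m) X (1\<^sub>m m)"
    using X Y YX by (subst mult_four_block_mat[of _ k k _ m _ m _ _ k _ m])
      (auto simp: cancel comm_add_mat[of "1\<^sub>m k" k k])
  hence "det (?N * ?M) = det (Y * X + 1\<^sub>m k)"
    using X YX by (simp add: det_four_block_mat_upper_right_zero[of _ k _ m])
  ultimately show ?thesis
    by (simp add: det_mult[OF M N] det_mult[OF N M] detN)
qed

text \<open>
  After Sylvester's identity the factor \<open>det A\<close> can be moved inside the determinant, where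
  \<open>A (B U V + I) = U V + A\<close>. An explicit right inverse \<open>B\<close> in place of an inversion operation keeps
  the identity meaningful over every integral domain.
\<close>

lemma matrix_determinant_lemma:
  fixes A B U V :: "'a :: idom mat"
  assumes A: "A \<in> carrier_mat k k" and B: "B \<in> carrier_mat k k" and AB: "A * B = 1\<^sub>m k"
    and U: "U \<in> carrier_mat k m" and V: "V \<in> carrier_mat m k"
  shows "det A * det (V * B * U + 1\<^sub>m m) = det (U * V + A)"
proof -
  have BU: "B * U \<in> carrier_mat k m" using B U by simp
  have "V * B * U = V * (B * U)" using B U V by simp
  hence "det A * det (V * B * U + 1\<^sub>m m) = det A * det (B * U * V + 1\<^sub>m k)"
    by (simp add: det_mult_plus_one_commute[OF V BU])
  also have "\<dots> = det (A * (B * U * V + 1\<^sub>m k))"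
    using A BU V by (subst det_mult[of _ k]) auto
  also have "A * (B * U * V + 1\<^sub>m k) = A * (B * U * V) + A"
    using A BU V by (simp add: mult_add_distrib_mat[of _ k k _ k])
  also have "A * (B * U * V) = A * B * (U * V)"
    using A B U V by (simp add: assoc_mult_mat[of _ k k _ k _ k] assoc_mult_mat[of _ k k _ m _ k])
  also have "\<dots> = U * V"
    using U V by (simp add: AB)
  finally show ?thesis .
qed

section \<open>Positive definiteness and inversion\<close>

text \<open>
  A vector \<open>v\<close> in the kernel of \<open>A\<close> has \<open>v \<bullet> A v = 0\<close>, which positivity allows only for \<open>v = 0\<close>.
\<close>

lemma det_sym_pos_def_nonzero:
  assumes "sym_pos_def k A"
  shows "det A \<noteq> 0"
proof
  assume "det A = 0"
  moreover have A: "A \<in> carrier_mat k k"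
    and pos: "\<And>v. v \<in> carrier_vec k \<Longrightarrow> v \<noteq> 0\<^sub>v k \<Longrightarrow> v \<bullet> (A *\<^sub>v v) > 0"
    using assms by (auto simp: sym_pos_def_def)
  ultimately obtain v where v: "v \<in> carrier_vec k" "v \<noteq> 0\<^sub>v k" "A *\<^sub>v v = 0\<^sub>v k"
    using det_0_iff_vec_prod_zero_field[OF A] by auto
  thus False using pos[of v] by simp
qed

text \<open>
  The hypothesis \<open>P P\<^sup>T = I\<close> provides the left inverse that makes \<open>P\<^sup>T\<close> injective, so that a nonzero
  \<open>x\<close> gives the positive value \<open>x \<bullet> (P G P\<^sup>T) x = (P\<^sup>T x) \<bullet> G (P\<^sup>T x)\<close>.
\<close>

lemma sym_pos_def_compression:
  assumes P: "P \<in> carrier_mat k d" and PPT: "P * transpose_mat P = 1\<^sub>m k"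
    and G: "sym_pos_def d G"
  shows "sym_pos_def k (P * G * transpose_mat P)"
proof -
  have Gc: "G \<in> carrier_mat d d" and Gsym: "transpose_mat G = G"
    and pos: "\<And>v. v \<in> carrier_vec d \<Longrightarrow> v \<noteq> 0\<^sub>v d \<Longrightarrow> v \<bullet> (G *\<^sub>v v) > 0"
    using G by (auto simp: sym_pos_def_def)
  let ?T = "transpose_mat P"
  have T: "?T \<in> carrier_mat d k" using P by simp
  have sym: "transpose_mat (P * G * ?T) = P * G * ?T"
  proof -
    have "transpose_mat (P * G * ?T) = P * (transpose_mat G * ?T)"
      unfolding transpose_mult[OF mult_carrier_mat[OF P Gc] T] transpose_mult[OF P Gc] by simp
    thus ?thesis unfolding Gsym using assoc_mult_mat[OF P Gc T] by simp
  qed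
  have "x \<bullet> (P * G * ?T *\<^sub>v x) > 0" if x: "x \<in> carrier_vec k" "x \<noteq> 0\<^sub>v k" for x
  proof -
    have Tx: "?T *\<^sub>v x \<in> carrier_vec d" using T x by simp
    have "?T *\<^sub>v x \<noteq> 0\<^sub>v d"
    proof
      assume "?T *\<^sub>v x = 0\<^sub>v d"
      hence "P *\<^sub>v (?T *\<^sub>v x) = 0\<^sub>v k" using P by auto
      moreover have "P *\<^sub>v (?T *\<^sub>v x) = x"
        using x assoc_mult_mat_vec[OF P T x(1)] by (simp add: PPT)
      ultimately show False using x by simp
    qed
    hence "(?T *\<^sub>v x) \<bullet> (G *\<^sub>v (?T *\<^sub>v x)) > 0" using pos Tx by blast
    also have "(?T *\<^sub>v x) \<bullet> (G *\<^sub>v (?T *\<^sub>v x)) = x \<bullet> (P *\<^sub>v (G *\<^sub>v (?T *\<^sub>v x)))"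
      using transpose_vec_mult_scalar[OF P _ x(1), of "G *\<^sub>v (?T *\<^sub>v x)"] Gc Tx by simp
    also have "P *\<^sub>v (G *\<^sub>v (?T *\<^sub>v x)) = P * G * ?T *\<^sub>v x"
      using P Gc T x Tx by (simp add: assoc_mult_mat_vec[of _ k d _ k]
          assoc_mult_mat_vec[of _ k d _ d])
    finally show ?thesis .
  qed
  thus ?thesis using P Gc T sym by (auto simp: sym_pos_def_def)
qed

lemma minv_right_inverse:
  assumes A: "A \<in> carrier_mat k k" and det: "det A \<noteq> 0"
  shows "A * minv A = 1\<^sub>m k" and "minv A \<in> carrier_mat k k"
proof -
  have "mat_inverse A \<noteq> None"
    using mat_inverse(1)[OF A, where b = "()"] det_non_zero_imp_unit[OF A det, where b = "()"]
    by blast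
  hence "mat_inverse A = Some (minv A)" by (auto simp: minv_def)
  thus "A * minv A = 1\<^sub>m k" "minv A \<in> carrier_mat k k"
    using mat_inverse(2)[OF A] by auto
qed

section \<open>Stacked matrices and selection matrices\<close>

lemma stack_rows_carrier:
  assumes "\<And>i. i \<in> set is \<Longrightarrow> F i \<in> carrier_mat (s i) n"
  shows "stack_rows n (map F is) \<in> carrier_mat (sum_list (map s is)) n"
  using assms by (induction "is") (auto simp: stack_rows_def)

lemma selection_mat_carrier:
  assumes "S \<subseteq> {0..<d}"
  shows "selection_mat d S \<in> carrier_mat (card S) d"
proof -
  have eq: "{i. i < d \<and> i \<in> S} = S" using assms by auto
  show ?thesis by (rule carrier_matI) (simp_all add: selection_mat_def dim_submatrix eq)
qed

lemma row_selection_mat: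
  assumes S: "S \<subseteq> {0..<d}" and i: "i < card S"
  shows "row (selection_mat d S) i = unit_vec d (pick S i)"
proof -
  have eq: "{i. i < d \<and> i \<in> S} = S" using S by auto
  have "pick S i < d" using pick_le[of i d S] i by (simp add: eq)
  thus ?thesis
    using i selection_mat_carrier[OF S]
    by (intro eq_vecI)
      (auto simp: selection_mat_def submatrix_index eq pick_UNIV unit_vec_def dim_submatrix)
qed

text \<open>
  Distinct row numbers pick distinct elements of \<open>S\<close>, so the rows of the selection matrix are
  pairwise different, hence orthonormal, unit vectors.
\<close>

lemma selection_mat_mult_transpose:
  assumes S: "S \<subseteq> {0..<d}"
  shows "selection_mat d S * transpose_mat (selection_mat d S) = 1\<^sub>m (card S)"
proof -
  let ?P = "selection_mat d S"
  have P: "?P \<in> carrier_mat (card S) d" by (rule selection_mat_carrier[OF S])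
  have eq: "{i. i < d \<and> i \<in> S} = S" using S by auto
  have entry: "row ?P i \<bullet> row ?P j = (if i = j then 1 else 0)"
    if "i < card S" "j < card S" for i j
  proof -
    have "pick S i < d" "pick S j < d"
      using pick_le[of i d S] pick_le[of j d S] that by (simp_all add: eq)
    moreover have "pick S i = pick S j \<longleftrightarrow> i = j"
      using that by (metis linorder_neq_iff pick_mono_le less_irrefl)
    ultimately show ?thesis using that by (auto simp: row_selection_mat[OF S])
  qed
  show ?thesis
    using P by (intro eq_matI) (auto simp: entry)
qed

section \<open>Expected information gain\<close>

theorem proposition3p1:
  fixes K n d :: nat
    and s :: "nat \<Rightarrow> nat"
    and F :: "nat \<Rightarrow> real mat"        \<comment> \<open>block maps\<close>
    and \<Gamma> :: "nat \<Rightarrow> real mat"        \<comment> \<open>noise covariance blocks\<close>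
    and \<Gamma>mm \<Gamma>e Fc Ft :: "real mat"
    and S :: "nat set"
  assumes d: "d = (\<Sum>i = 1..K. s i)"
    and F: "\<And>i. i \<in> {1..K} \<Longrightarrow> F i \<in> carrier_mat (s i) n"
    and Fc: "Fc = stack_rows n (map F [1..<Suc K])"
    and \<Gamma>mm: "sym_pos_def n \<Gamma>mm"
    and Ft: "Ft = Fc * spd_sqrt \<Gamma>mm"
    and \<Gamma>: "\<And>i. i \<in> {1..K} \<Longrightarrow> \<Gamma> i \<in> carrier_mat (s i) (s i)"
    and \<Gamma>e: "\<Gamma>e = diag_block_mat (map \<Gamma> [1..<Suc K])"
    and \<Gamma>e_spd: "sym_pos_def d \<Gamma>e"
    and S: "S \<subseteq> {0..<d}"
  shows "expected_information_gain Ft \<Gamma>e S =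
    1 / 2 * ln (det (selection_mat d S * (Ft * transpose_mat Ft + \<Gamma>e) * transpose_mat (selection_mat d S))
              / det (selection_mat d S * \<Gamma>e * transpose_mat (selection_mat d S)))"
proof -
  let ?P = "selection_mat d S"
  let ?T = "transpose_mat ?P"
  let ?A = "?P * \<Gamma>e * ?T"
  let ?B = "minv ?A"
  let ?Ft = "transpose_mat Ft"
  define k where "k = card S"
  define m where "m = dim_col Ft"
  have \<Gamma>ec: "\<Gamma>e \<in> carrier_mat d d" using \<Gamma>e_spd by (simp add: sym_pos_def_def)
  have "sum_list (map s [1..<Suc K]) = d"
    unfolding d sum_list_distinct_conv_sum_set[OF distinct_upt] by (rule sum.cong) auto
  moreover have "stack_rows n (map F [1..<Suc K]) \<in> carrier_mat (sum_list (map s [1..<Suc K])) n"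
    by (rule stack_rows_carrier) (use F in auto)
  ultimately have "Fc \<in> carrier_mat d n" unfolding Fc by metis
  hence "dim_row Ft = d" unfolding Ft by simp
  hence Ftc: "Ft \<in> carrier_mat d m" unfolding m_def by (intro carrier_matI) simp_all
  have P: "?P \<in> carrier_mat k d" unfolding k_def by (rule selection_mat_carrier[OF S])
  have T: "?T \<in> carrier_mat d k" and FtT: "?Ft \<in> carrier_mat m d" using P Ftc by simp_all
  have A: "?A \<in> carrier_mat k k" using P \<Gamma>ec T by simp
  have detA: "det ?A \<noteq> 0"
    using det_sym_pos_def_nonzero sym_pos_def_compression[OF P _ \<Gamma>e_spd]
      selection_mat_mult_transpose[OF S] unfolding k_def by blast
  have B: "?B \<in> carrier_mat k k" and AB: "?A * ?B = 1\<^sub>m k"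
    using minv_right_inverse[OF A detA] by simp_all
  have U: "?P * Ft \<in> carrier_mat k m" and V: "?Ft * ?T \<in> carrier_mat m k"
    using P Ftc T FtT by simp_all
  have "dim_row \<Gamma>e = d" using \<Gamma>ec by simp
  hence "?Ft * select_precision \<Gamma>e S * Ft = ?Ft * (?T * ?B * ?P) * Ft"
    by (simp add: select_precision_def Let_def)
  also have "\<dots> = ?Ft * ?T * ?B * (?P * Ft)"
  proof -
    have TB: "?T * ?B \<in> carrier_mat d k" using T B by simp
    have "?Ft * (?T * ?B * ?P) * Ft = ?Ft * (?T * ?B) * ?P * Ft"
      using assoc_mult_mat[OF FtT TB P] by simp
    also have "\<dots> = ?Ft * ?T * ?B * ?P * Ft"
      using assoc_mult_mat[OF FtT T B] by simp
    also have "\<dots> = ?Ft * ?T * ?B * (?P * Ft)"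
      using assoc_mult_mat[OF mult_carrier_mat[OF V B] P Ftc] by simp
    finally show ?thesis .
  qed
  finally have gain: "?Ft * select_precision \<Gamma>e S * Ft = ?Ft * ?T * ?B * (?P * Ft)" .
  have FFt: "Ft * ?Ft \<in> carrier_mat d d" using Ftc FtT by simp
  have "?P * (Ft * ?Ft + \<Gamma>e) * ?T = ?P * (Ft * ?Ft) * ?T + ?A"
    unfolding mult_add_distrib_mat[OF P FFt \<Gamma>ec]
    by (rule add_mult_distrib_mat[OF mult_carrier_mat[OF P FFt] mult_carrier_mat[OF P \<Gamma>ec] T])
  also have "?P * (Ft * ?Ft) * ?T = ?P * Ft * (?Ft * ?T)"
    using assoc_mult_mat[OF P Ftc FtT] assoc_mult_mat[OF U FtT T] by simp
  finally have "det (?P * (Ft * ?Ft + \<Gamma>e) * ?T) = det ?A * det (?Ft * ?T * ?B * (?P * Ft) + 1\<^sub>m m)"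
    using matrix_determinant_lemma[OF A B AB U V] by simp
  thus ?thesis
    using detA by (simp add: expected_information_gain_def gain m_def)
qed

end
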